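(* Fix a real number $0<r\le 1$ and let $k=\lfloor 1/r\rfloor$. Then there exists a constant $d_r$ with $0<d_r\le 1$ (depending only on $r$) such that for all sufficiently large positive integers $n$, \[ d_r\,\omega(n,k)\le Q(n,\lceil rn\rceil)\le \omega(n,k). \]
   Context: All graphs are finite and simple. For a graph $G$, $\omega(G)$, $\alpha(G)$ and $\chi(G)$ denote its clique number, independence number and chromatic number, and $|G|$ its number of vertices. For positive integers $n,k$, the inverse Ramsey number is $\omega(n,k)=\min\{\omega(G): |G|=n \text{ and } \alpha(G)\le k\}$. For positive integers $n,c$, $Q(n,c)=\min\{\omega(G): |G|=n \text{ and } \chi(G)=c\}$. *)

theory Defs
  imports Complex_Main "HOL-Library.Ramsey"
begin

text \<open>
  A graph is a vertex set \<open>V\<close> with a set \<open>E\<close> of two-element subsets of \<open>V\<close>, the encoding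
  for which \<open>clique\<close> and \<open>indep\<close> are defined in \<open>HOL-Library.Ramsey\<close>.
\<close>

definition finite_simple_graph :: "'a set \<Rightarrow> 'a set set \<Rightarrow> bool" where
  "finite_simple_graph V E \<longleftrightarrow> finite V \<and> E \<subseteq> [V]\<^bsup>2\<^esup>"

definition clique_number :: "'a set \<Rightarrow> 'a set set \<Rightarrow> nat" where
  "clique_number V E = Max {card K | K. K \<subseteq> V \<and> clique K E}"

definition independence_number :: "'a set \<Rightarrow> 'a set set \<Rightarrow> nat" where
  "independence_number V E = Max {card I | I. I \<subseteq> V \<and> indep I E}"

definition proper_coloring :: "'a set \<Rightarrow> 'a set set \<Rightarrow> nat \<Rightarrow> ('a \<Rightarrow> nat) \<Rightarrow> bool" where
  "proper_coloring V E c f \<longleftrightarrow>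
     f ` V \<subseteq> {..<c} \<and> (\<forall>u\<in>V. \<forall>v\<in>V. {u, v} \<in> E \<longrightarrow> f u \<noteq> f v)"

definition chromatic_number :: "'a set \<Rightarrow> 'a set set \<Rightarrow> nat" where
  "chromatic_number V E = (LEAST c. \<exists>f. proper_coloring V E c f)"

text \<open>
  The minima below range over graphs with vertices in \<open>nat\<close>; every finite graph is isomorphic
  to one of these. They are infima of sets of naturals, hence attained as soon as the set is
  non-empty, which is the case for \<open>n, k \<ge> 1\<close> and for \<open>1 \<le> c \<le> n\<close> respectively (see the
  lemmas at the end). On the empty set \<open>Inf\<close> has the junk value \<open>0\<close>.
\<close>

definition inverse_ramsey :: "nat \<Rightarrow> nat \<Rightarrow> nat" where
  "inverse_ramsey n k =
     Inf {clique_number V E | (V :: nat set) E.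
            finite_simple_graph V E \<and> card V = n \<and> independence_number V E \<le> k}"

definition Q :: "nat \<Rightarrow> nat \<Rightarrow> nat" where
  "Q n c =
     Inf {clique_number V E | (V :: nat set) E.
            finite_simple_graph V E \<and> card V = n \<and> chromatic_number V E = c}"

lemma inverse_ramsey_attained:
  assumes "k \<ge> 1"
  shows "\<exists>(V :: nat set) E. finite_simple_graph V E \<and> card V = n \<and>
           independence_number V E \<le> k \<and> clique_number V E = inverse_ramsey n k"
proof -
  let ?V = "{..<n}" and ?E = "[{..<n}]\<^bsup>2\<^esup>"
  let ?A = "{card I | I. I \<subseteq> ?V \<and> indep I ?E}"
  have "card I \<le> 1" if "I \<subseteq> ?V" "indep I ?E" for I
  proof -
    have "\<forall>u\<in>I. \<forall>v\<in>I. u = v"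
      using that by (auto simp: indep_def)
    then show ?thesis
      using finite_subset[OF that(1)] by (auto simp: card_le_Suc0_iff_eq)
  qed
  moreover from this have "finite ?A"
    by (auto intro!: finite_subset[of ?A "{..1}"])
  moreover have "0 \<in> ?A"
    by (auto intro!: exI[of _ "{}"])
  ultimately have "Max ?A \<le> 1"
    by (subst Max_le_iff) auto
  then have "clique_number ?V ?E \<in> {clique_number V E | (V :: nat set) E.
            finite_simple_graph V E \<and> card V = n \<and> independence_number V E \<le> k}"
    using assms by (fastforce simp: independence_number_def finite_simple_graph_def)
  then have "inverse_ramsey n k \<in> {clique_number V E | (V :: nat set) E.
            finite_simple_graph V E \<and> card V = n \<and> independence_number V E \<le> k}"
    unfolding inverse_ramsey_def by (intro Inf_nat_def1) blast
  then show ?thesis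
    by force
qed

lemma Q_attained:
  assumes "1 \<le> c" "c \<le> n"
  shows "\<exists>(V :: nat set) E. finite_simple_graph V E \<and> card V = n \<and>
           chromatic_number V E = c \<and> clique_number V E = Q n c"
proof -
  let ?V = "{..<n}" and ?E = "[{..<c}]\<^bsup>2\<^esup>"
  have "chromatic_number ?V ?E = c"
    unfolding chromatic_number_def
  proof (rule Least_equality)
    show "\<exists>f. proper_coloring ?V ?E c f"
      using assms
      by (intro exI[of _ "\<lambda>v. if v < c then v else 0"]) (auto simp: proper_coloring_def)
  next
    fix b assume "\<exists>f. proper_coloring ?V ?E b f"
    then obtain f where f: "proper_coloring ?V ?E b f" ..
    then have "inj_on f {..<c}" "f ` {..<c} \<subseteq> {..<b}"
      using assms by (force simp: proper_coloring_def inj_on_def)+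
    then show "c \<le> b"
      using card_inj_on_le[of f "{..<c}" "{..<b}"] by simp
  qed
  moreover have "finite_simple_graph ?V ?E"
    using assms nsets_mono[of "{..<c}" "{..<n}"] by (auto simp: finite_simple_graph_def)
  ultimately have "clique_number ?V ?E \<in> {clique_number V E | (V :: nat set) E.
            finite_simple_graph V E \<and> card V = n \<and> chromatic_number V E = c}"
    by fastforce
  then have "Q n c \<in> {clique_number V E | (V :: nat set) E.
            finite_simple_graph V E \<and> card V = n \<and> chromatic_number V E = c}"
    unfolding Q_def by (intro Inf_nat_def1) blast
  then show ?thesis
    by force
qed

end

theory Submission
  imports Defs
begin

text \<open>
  With \<open>c = \<lceil>r n\<rceil>\<close> and \<open>1 / (k + 1) < r \<le> 1 / k\<close>: a graph with independence number at most \<open>k\<close>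
  has chromatic number at least \<open>n / k \<ge> r n\<close>, and deleting edges one at a time lowers the
  chromatic number in steps of at most one, so it hits \<open>c\<close>; this gives the upper bound.
  For the lower bound, remove disjoint independent sets of size \<open>k + 1\<close> from a graph with chromatic
  number \<open>c\<close> as long as possible. If \<open>m\<close> vertices remain after \<open>t\<close> removals, then
  \<open>r n \<le> t + m\<close> and \<open>n = m + (k + 1) t\<close>, which forces \<open>m\<close> to be a fixed fraction of \<open>n\<close>, say
  \<open>n \<le> N m\<close>. The remaining graph has clique number at least \<open>\<omega>(m, k)\<close>, and the join of \<open>N\<close> copies
  of an optimal graph on \<open>m\<close> vertices shows that \<open>\<omega>(n, k) \<le> N \<omega>(m, k)\<close>.
\<close>

section \<open>Bounds for clique and independence numbers\<close>

lemma finite_subset_cards: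
  assumes "finite V"
  shows "finite {card K | K. K \<subseteq> V \<and> P K}"
  using assms by (auto intro: finite_subset[of _ "card ` Pow V"])

lemma card_le_clique_number:
  assumes "finite V" "K \<subseteq> V" "clique K E"
  shows "card K \<le> clique_number V E"
  unfolding clique_number_def using assms finite_subset_cards[of V] by (intro Max_ge) auto

lemma clique_number_le:
  assumes "finite V" "\<And>K. K \<subseteq> V \<Longrightarrow> clique K E \<Longrightarrow> card K \<le> c"
  shows "clique_number V E \<le> c"
proof -
  have "clique {} E"
    by (simp add: clique_def)
  then show ?thesis
    unfolding clique_number_def using assms finite_subset_cards[of V] by (subst Max_le_iff) auto
qed

lemma card_le_independence_number:
  assumes "finite V" "I \<subseteq> V" "indep I E"
  shows "card I \<le> independence_number V E"
  unfolding independence_number_def using assms finite_subset_cards[of V] by (intro Max_ge) auto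

lemma independence_number_le:
  assumes "finite V" "\<And>I. I \<subseteq> V \<Longrightarrow> indep I E \<Longrightarrow> card I \<le> c"
  shows "independence_number V E \<le> c"
proof -
  have "indep {} E"
    by (simp add: indep_def)
  then show ?thesis
    unfolding independence_number_def using assms finite_subset_cards[of V]
    by (subst Max_le_iff) auto
qed

lemma clique_number_mono:
  assumes "finite V'" "V \<subseteq> V'" "E \<subseteq> E'"
  shows "clique_number V E \<le> clique_number V' E'"
proof (rule clique_number_le)
  fix K assume "K \<subseteq> V" "clique K E"
  then have "K \<subseteq> V'" "clique K E'"
    using assms by (auto simp: clique_def)
  then show "card K \<le> clique_number V' E'"
    using assms card_le_clique_number by blast
qed (use assms finite_subset in blast)

lemma inverse_ramsey_le:
  fixes V :: "nat set"
  assumes "finite_simple_graph V E" "independence_number V E \<le> k"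
  shows "inverse_ramsey (card V) k \<le> clique_number V E"
  unfolding inverse_ramsey_def using assms by (intro cInf_lower) auto

lemma Q_le:
  fixes V :: "nat set"
  assumes "finite_simple_graph V E"
  shows "Q (card V) (chromatic_number V E) \<le> clique_number V E"
  unfolding Q_def using assms by (intro cInf_lower) auto

section \<open>Joins of copies of a graph\<close>

lemma card_fibres_le:
  assumes "finite A" "f ` A \<subseteq> {..<c :: nat}" "\<And>i. i < c \<Longrightarrow> card {x \<in> A. f x = i} \<le> b"
  shows "card A \<le> c * b"
proof -
  have "A = (\<Union>i<c. {x \<in> A. f x = i})"
    using assms(2) by auto
  then have "card A \<le> (\<Sum>i<c. card {x \<in> A. f x = i})"
    using card_UN_le[of "{..<c}" "\<lambda>i. {x \<in> A. f x = i}"] by simp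
  also have "\<dots> \<le> c * b"
    using sum_bounded_above[of "{..<c}" "\<lambda>i. card {x \<in> A. f x = i}" b] assms(3) by simp
  finally show ?thesis .
qed

text \<open>Place \<open>n\<close> vertices in \<open>N\<close> copies of an optimal graph on
  \<open>m\<close> vertices and join different copies completely. An independent set then lies in
  one copy, while a clique splits into at most \<open>N\<close> cliques of the optimal
  graph.\<close>

lemma inverse_ramsey_le_mult:
  assumes "k \<ge> 1" "n \<le> N * m"
  shows "inverse_ramsey n k \<le> N * inverse_ramsey m k"
proof -
  obtain V :: "nat set" and E where G: "finite_simple_graph V E" "card V = m"
      "independence_number V E \<le> k" "clique_number V E = inverse_ramsey m k"
    using inverse_ramsey_attained[OF assms(1)] by blast
  have fin: "finite V"
    using G by (simp add: finite_simple_graph_def)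
  have "card {..<n} \<le> card (V \<times> {..<N})"
    using assms(2) G by (simp add: card_cartesian_product mult.commute)
  \<comment> \<open>\<open>f\<close> sends a vertex to a pair: its vertex in the optimal graph and
    the index of its copy.\<close>
  then obtain f where f: "inj_on f {..<n}" "f ` {..<n} \<subseteq> V \<times> {..<N}"
    using card_le_inj[of "{..<n}" "V \<times> {..<N}"] fin by auto
  define adj where
    "adj u v \<longleftrightarrow> snd (f u) \<noteq> snd (f v) \<or> {fst (f u), fst (f v)} \<in> E" for u v
  define F where "F = {{u, v} | u v. u < n \<and> v < n \<and> u \<noteq> v \<and> adj u v}"
  have adj_sym: "adj u v \<longleftrightarrow> adj v u" for u v
    unfolding adj_def by (auto simp: insert_commute)
  have F_iff: "{u, v} \<in> F \<longleftrightarrow> u < n \<and> v < n \<and> u \<noteq> v \<and> adj u v" for u v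
    unfolding F_def using adj_sym by (auto simp: doubleton_eq_iff)
  have graph: "finite_simple_graph {..<n} F"
    by (auto simp: finite_simple_graph_def F_def nsets_def card_2_iff)
  have f_eqI: "u = v" if "u < n" "v < n" "fst (f u) = fst (f v)" "snd (f u) = snd (f v)" for u v
    using f(1) that by (meson inj_onD lessThan_iff prod_eqI)
  have fV: "fst (f u) \<in> V" "snd (f u) < N" if "u < n" for u
    using f(2) that by (fastforce simp: image_subset_iff mem_Times_iff)+

  have "independence_number {..<n} F \<le> k"
  proof (rule independence_number_le)
    fix I assume I: "I \<subseteq> {..<n}" "indep I F"
    \<comment> \<open>Vertices in different copies are always adjacent, so \<open>I\<close> stays in
      one copy and \<open>fst\<close> embeds it into \<open>V\<close>.\<close>
    have one_fibre: "snd (f u) = snd (f v)" and nonadj: "{fst (f u), fst (f v)} \<notin> E"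
      if "u \<in> I" "v \<in> I" "u \<noteq> v" for u v
      using I that by (auto simp: indep_def F_iff adj_def)
    have "inj_on (fst \<circ> f) I"
      using I one_fibre by (intro inj_onI) (metis comp_apply f_eqI lessThan_iff subsetD)
    moreover have "indep ((fst \<circ> f) ` I) E"
      using nonadj by (auto simp: indep_def)
    moreover have "(fst \<circ> f) ` I \<subseteq> V"
      using I fV by auto
    ultimately show "card I \<le> k"
      using card_le_independence_number[OF fin] G(3) by (metis card_image order_trans)
  qed simp
  moreover have "clique_number {..<n} F \<le> N * clique_number V E"
  proof (rule clique_number_le)
    fix K assume K: "K \<subseteq> {..<n}" "clique K F"
    show "card K \<le> N * clique_number V E"
    proof (rule card_fibres_le)
      show "finite K"
        using K finite_subset by blast
      show "(snd \<circ> f) ` K \<subseteq> {..<N}"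
        using K fV by auto
      fix i
      let ?K = "{x \<in> K. (snd \<circ> f) x = i}"
      have "{fst (f u), fst (f v)} \<in> E"
        if "u \<in> K" "v \<in> K" "fst (f u) \<noteq> fst (f v)" "snd (f u) = snd (f v)" for u v
        using K(2) that by (auto simp: clique_def F_iff adj_def)
      then have "clique ((fst \<circ> f) ` ?K) E"
        by (auto simp: clique_def)
      moreover have "inj_on (fst \<circ> f) ?K"
        by (rule inj_onI, rule f_eqI) (use K in auto)
      moreover have "(fst \<circ> f) ` ?K \<subseteq> V"
        using K fV by auto
      ultimately show "card ?K \<le> clique_number V E"
        using card_le_clique_number[OF fin, of "(fst \<circ> f) ` ?K" E] card_image[of "fst \<circ> f" ?K]
        by simp
    qed
  qed simp
  ultimately show ?thesis
    using inverse_ramsey_le[OF graph, of k] G(4) by simp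
qed

section \<open>Colorings and the chromatic number\<close>

lemma chromatic_number_le:
  "proper_coloring V E c f \<Longrightarrow> chromatic_number V E \<le> c"
  unfolding chromatic_number_def by (auto intro: Least_le)

text \<open>\<open>proper_coloring\<close> also tests \<open>u = v\<close>, where
  \<open>{u, v}\<close> collapses to a singleton; each construction of a coloring has to exclude
  that case.\<close>

lemma not_singleton_edge: "E \<subseteq> [V]\<^bsup>2\<^esup> \<Longrightarrow> {u} \<notin> E"
  by (auto simp: nsets_def)

lemma proper_coloring_card:
  assumes "finite S" "E \<subseteq> [V]\<^bsup>2\<^esup>"
  shows "\<exists>f. proper_coloring S E (card S) f"
proof -
  obtain f where f: "bij_betw f S {..<card S}"
    using ex_bij_betw_finite_nat[OF assms(1)] by (auto simp: atLeast0LessThan)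
  have "proper_coloring S E (card S) f"
    using f not_singleton_edge[OF assms(2)]
    by (auto simp: proper_coloring_def bij_betw_def inj_on_def)
  then show ?thesis
    by blast
qed

lemma proper_coloring_chromatic_number:
  assumes "finite_simple_graph V E"
  shows "\<exists>f. proper_coloring V E (chromatic_number V E) f"
proof -
  have "\<exists>f. proper_coloring V E (card V) f"
    using assms proper_coloring_card[of V E V] by (simp add: finite_simple_graph_def)
  then show ?thesis
    unfolding chromatic_number_def by (rule LeastI)
qed

text \<open>Each color class is independent, hence has at most \<open>k\<close> vertices.\<close>

lemma card_le_chromatic_number_mult:
  assumes "finite_simple_graph V E" "independence_number V E \<le> k"
  shows "card V \<le> chromatic_number V E * k"
proof -
  have fin: "finite V"
    using assms by (simp add: finite_simple_graph_def)
  obtain f where f: "proper_coloring V E (chromatic_number V E) f"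
    using proper_coloring_chromatic_number[OF assms(1)] ..
  show ?thesis
  proof (rule card_fibres_le[OF fin])
    show "f ` V \<subseteq> {..<chromatic_number V E}"
      using f by (simp add: proper_coloring_def)
    fix i
    have "indep {v \<in> V. f v = i} E"
      using f unfolding indep_def proper_coloring_def by force
    then show "card {v \<in> V. f v = i} \<le> k"
      using card_le_independence_number[OF fin, of "{v \<in> V. f v = i}" E] assms(2) by simp
  qed
qed

text \<open>Recolor one end of the new edge with a fresh color.\<close>

lemma chromatic_number_insert_le:
  assumes "finite V" "insert e E \<subseteq> [V]\<^bsup>2\<^esup>"
  shows "chromatic_number V (insert e E) \<le> Suc (chromatic_number V E)"
proof -
  let ?c = "chromatic_number V E"
  obtain u v where e: "e = {u, v}" "u \<in> V" "u \<noteq> v"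
    using assms(2) by (auto simp: nsets_def card_2_iff)
  obtain f where f: "proper_coloring V E ?c f"
    using proper_coloring_chromatic_number[of V E] assms by (auto simp: finite_simple_graph_def)
  have "proper_coloring V (insert e E) (Suc ?c) (f(u := ?c))"
    unfolding proper_coloring_def
  proof (intro conjI ballI impI)
    have lt: "f x < ?c" if "x \<in> V" for x
      using f that by (auto simp: proper_coloring_def)
    then show "(f(u := ?c)) ` V \<subseteq> {..<Suc ?c}"
      by (auto simp: less_Suc_eq)
    fix x y assume xy: "x \<in> V" "y \<in> V" "{x, y} \<in> insert e E"
    then have "x \<noteq> y"
      using not_singleton_edge[OF assms(2)] by auto
    moreover have "f x \<noteq> f y" if "x \<noteq> u" "y \<noteq> u"
      using xy f that by (auto simp: proper_coloring_def e(1))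
    ultimately show "(f(u := ?c)) x \<noteq> (f(u := ?c)) y"
      using lt[OF xy(1)] lt[OF xy(2)] by auto
  qed
  then show ?thesis
    by (rule chromatic_number_le)
qed

text \<open>A discrete intermediate value argument: as edges are inserted one by one, the chromatic
  number starts at most at 1 and never jumps by more than one.\<close>

lemma subgraph_with_chromatic_number:
  assumes "finite V" "finite E" "E \<subseteq> [V]\<^bsup>2\<^esup>" "1 \<le> c" "c \<le> chromatic_number V E"
  shows "\<exists>F\<subseteq>E. chromatic_number V F = c"
  using assms(2,3,5)
proof (induction E rule: finite_induct)
  case empty
  have "proper_coloring V {} 1 (\<lambda>_. 0)"
    by (auto simp: proper_coloring_def)
  then have "chromatic_number V {} = c"
    using chromatic_number_le empty assms(4) by (metis le_antisym le_trans)
  then show ?case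
    by blast
next
  case (insert e E)
  show ?case
  proof (cases "c \<le> chromatic_number V E")
    case True
    then show ?thesis
      using insert by blast
  next
    case False
    then have "chromatic_number V (insert e E) = c"
      using chromatic_number_insert_le[OF assms(1) insert.prems(1)] insert.prems(2) by linarith
    then show ?thesis
      by blast
  qed
qed

section \<open>Removing independent sets\<close>

lemma proper_coloring_add_indep:
  assumes "proper_coloring (V - I) E c f" "indep I E" "E \<subseteq> [W]\<^bsup>2\<^esup>"
  shows "proper_coloring V E (Suc c) (\<lambda>v. if v \<in> I then c else f v)"
  unfolding proper_coloring_def
proof (intro conjI ballI impI)
  have lt: "f x < c" if "x \<in> V - I" for x
    using assms(1) that by (auto simp: proper_coloring_def)
  then show "(\<lambda>v. if v \<in> I then c else f v) ` V \<subseteq> {..<Suc c}"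
    by (auto simp: less_Suc_eq)
  fix x y assume xy: "x \<in> V" "y \<in> V" "{x, y} \<in> E"
  then have "x \<noteq> y"
    using not_singleton_edge[OF assms(3)] by auto
  then have "\<not> (x \<in> I \<and> y \<in> I)"
    using xy assms(2) by (auto simp: indep_def)
  moreover have "f x \<noteq> f y" if "x \<notin> I" "y \<notin> I"
    using xy assms(1) that by (auto simp: proper_coloring_def)
  ultimately show "(if x \<in> I then c else f x) \<noteq> (if y \<in> I then c else f y)"
    using lt[of x] lt[of y] xy by auto
qed

text \<open>Greedy removal: each removed set costs one color, and the vertices of the remainder
  \<open>S\<close> get pairwise distinct colors.\<close>

lemma remove_independent_sets:
  assumes "finite V" "E \<subseteq> [W]\<^bsup>2\<^esup>"
  shows "\<exists>S t f. S \<subseteq> V \<and> independence_number S E \<le> k \<and> card V = card S + Suc k * t \<and>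
           proper_coloring V E (card S + t) f"
  using assms(1)
proof (induction "card V" arbitrary: V rule: less_induct)
  case less
  show ?case
  proof (cases "independence_number V E \<le> k")
    case True
    then show ?thesis
      using proper_coloring_card[OF less.prems assms(2)]
      by (intro exI[of _ V] exI[of _ 0]) auto
  next
    case False
    then obtain J where J: "J \<subseteq> V" "indep J E" "\<not> card J \<le> k"
      using independence_number_le[OF less.prems] by blast
    \<comment> \<open>Shrinking \<open>J\<close> to exactly \<open>k + 1\<close> vertices makes the
      count of \<open>card V\<close> an equation.\<close>
    then obtain I where I: "I \<subseteq> J" "card I = Suc k"
      by (meson not_less_eq_eq obtain_subset_with_card_n)
    have "indep I E" "I \<subseteq> V"
      using I J by (auto simp: indep_def)
    then have card_V: "card V = card (V - I) + Suc k"
      using less.prems I(2)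
      by (metis card_Diff_subset card_mono finite_subset le_add_diff_inverse2)
    then obtain S t f where S: "S \<subseteq> V - I" "independence_number S E \<le> k"
        "card (V - I) = card S + Suc k * t" "proper_coloring (V - I) E (card S + t) f"
      using less.hyps[of "V - I"] less.prems by auto
    have "proper_coloring V E (card S + Suc t) (\<lambda>v. if v \<in> I then card S + t else f v)"
      using proper_coloring_add_indep[OF S(4) \<open>indep I E\<close> assms(2)] by simp
    moreover have "card V = card S + Suc k * Suc t"
      using card_V S(3) by simp
    ultimately show ?thesis
      using S(1,2) by blast
  qed
qed

text \<open>Here \<open>m\<close> is the size of the remainder and \<open>t\<close> the number of
  removed sets; the remainder induces a graph that competes in the minimum defining
  \<open>inverse_ramsey m k\<close>.\<close>

lemma inverse_ramsey_le_clique_number: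
  fixes V :: "nat set"
  assumes "finite_simple_graph V E"
  shows "\<exists>m t. card V = m + Suc k * t \<and> chromatic_number V E \<le> m + t \<and>
           inverse_ramsey m k \<le> clique_number V E"
proof -
  have fin: "finite V" and E: "E \<subseteq> [V]\<^bsup>2\<^esup>"
    using assms by (auto simp: finite_simple_graph_def)
  obtain S t f where S: "S \<subseteq> V" "independence_number S E \<le> k" "card V = card S + Suc k * t"
      "proper_coloring V E (card S + t) f"
    using remove_independent_sets[OF fin E, of k] by blast
  let ?F = "E \<inter> [S]\<^bsup>2\<^esup>"
  have "finite S"
    using S fin finite_subset by blast
  have graph: "finite_simple_graph S ?F"
    using \<open>finite S\<close> by (simp add: finite_simple_graph_def)
  have "independence_number S ?F \<le> k"
  proof (rule independence_number_le[OF \<open>finite S\<close>])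
    fix I assume I: "I \<subseteq> S" "indep I ?F"
    then have "indep I E"
      by (auto simp: indep_def nsets_def)
    then show "card I \<le> k"
      using card_le_independence_number[OF \<open>finite S\<close>] I S(2) by (meson order_trans)
  qed
  then have "inverse_ramsey (card S) k \<le> clique_number S ?F"
    by (rule inverse_ramsey_le[OF graph])
  also have "\<dots> \<le> clique_number V E"
    using fin S(1) by (intro clique_number_mono) auto
  finally show ?thesis
    using S(3) chromatic_number_le[OF S(4)] by blast
qed

text \<open>The last assumption expresses c \<le> \<lceil>n / k\<rceil> without division. Deleting
  edges to reach chromatic number \<open>c\<close> cannot raise the clique number.\<close>

lemma Q_le_inverse_ramsey:
  assumes "1 \<le> k" "1 \<le> c" "\<And>x. n \<le> x * k \<Longrightarrow> c \<le> x"
  shows "Q n c \<le> inverse_ramsey n k"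
proof -
  obtain V :: "nat set" and E where G: "finite_simple_graph V E" "card V = n"
      "independence_number V E \<le> k" "clique_number V E = inverse_ramsey n k"
    using inverse_ramsey_attained[OF assms(1)] by blast
  have fin: "finite V" and E: "E \<subseteq> [V]\<^bsup>2\<^esup>"
    using G(1) by (auto simp: finite_simple_graph_def)
  have "finite E"
    using fin E finite_imp_finite_nsets finite_subset by blast
  moreover have "c \<le> chromatic_number V E"
    using assms(3) card_le_chromatic_number_mult[OF G(1,3)] G(2) by blast
  ultimately obtain F where F: "F \<subseteq> E" "chromatic_number V F = c"
    using subgraph_with_chromatic_number[OF fin _ E assms(2)] by blast
  then have "Q n c \<le> clique_number V F"
    using Q_le[of V F] G(1,2) by (auto simp: finite_simple_graph_def)
  also have "\<dots> \<le> clique_number V E"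
    using fin F by (intro clique_number_mono) auto
  finally show ?thesis
    using G(4) by simp
qed

theorem theorem1p2:
  fixes r :: real and k :: nat
  assumes "0 < r" and "r \<le> 1" and "k = nat \<lfloor>1 / r\<rfloor>"
  shows "\<exists>d :: real. 0 < d \<and> d \<le> 1 \<and>
           (\<forall>\<^sub>F n in sequentially.
              d * real (inverse_ramsey n k) \<le> real (Q n (nat \<lceil>r * real n\<rceil>)) \<and>
              Q n (nat \<lceil>r * real n\<rceil>) \<le> inverse_ramsey n k)"
proof -
  have "1 \<le> 1 / r"
    using assms by simp
  then have "1 \<le> \<lfloor>1 / r\<rfloor>"
    by simp
  then have k1: "1 \<le> k" and k_floor: "real k = of_int \<lfloor>1 / r\<rfloor>"
    using assms(3) by linarith+
  have kr: "real k * r \<le> 1"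
    using k_floor assms(1) of_int_floor_le[of "1 / r"] by (simp flip: pos_le_divide_eq)
  have "1 / r < real k + 1"
    using k_floor by linarith
  \<comment> \<open>The strict inequality 1 / r < k + 1 from the floor is what keeps the remainder a
    positive fraction of all vertices.\<close>
  then have pos: "0 < (real k + 1) * r - 1"
    using assms(1) by (simp add: field_simps)
  \<comment> \<open>Chosen so that the bound \<open>*\<close> below, ((k + 1) r - 1) n \<le> k m,
    yields n \<le> N m.\<close>
  define N where "N = nat \<lceil>real k / ((real k + 1) * r - 1)\<rceil>"
  have "0 < real k / ((real k + 1) * r - 1)"
    using pos k1 by simp
  then have N1: "1 \<le> N"
    unfolding N_def by linarith
  have "real k / ((real k + 1) * r - 1) \<le> real N"
    unfolding N_def by linarith
  then have kN: "real k \<le> real N * ((real k + 1) * r - 1)"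
    using pos by (simp add: pos_divide_le_eq)
  have main: "1 / real N * real (inverse_ramsey n k) \<le> real (Q n (nat \<lceil>r * real n\<rceil>)) \<and>
      Q n (nat \<lceil>r * real n\<rceil>) \<le> inverse_ramsey n k" if "1 \<le> n" for n
  proof
    let ?c = "nat \<lceil>r * real n\<rceil>"
    have "0 < r * real n"
      using that assms(1) by simp
    then have c1: "1 \<le> ?c"
      by linarith
    \<comment> \<open>With \<open>c1\<close>, this puts \<open>?c\<close> in the range where
      \<open>Q_attained\<close> applies.\<close>
    have "r * real n \<le> real n"
      using assms by (simp add: mult_left_le_one_le)
    then have cn: "?c \<le> n"
      by (simp add: ceiling_le_iff nat_le_iff)
    show "Q n ?c \<le> inverse_ramsey n k"
    proof (rule Q_le_inverse_ramsey[OF k1 c1])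
      fix x assume "n \<le> x * k"
      then have "r * real n \<le> r * (real x * real k)"
        using assms(1) by (metis less_imp_le mult_left_mono of_nat_le_iff of_nat_mult)
      also have "\<dots> = real x * (real k * r)"
        by simp
      also have "\<dots> \<le> real x"
        using kr by (simp add: mult_left_le)
      finally show "?c \<le> x"
        by (simp add: ceiling_le_iff nat_le_iff)
    qed
    obtain V :: "nat set" and E where G: "finite_simple_graph V E" "card V = n"
        "chromatic_number V E = ?c" "clique_number V E = Q n ?c"
      using Q_attained[OF c1 cn] by blast
    obtain m t where mt: "n = m + Suc k * t" "?c \<le> m + t" "inverse_ramsey m k \<le> Q n ?c"
      using inverse_ramsey_le_clique_number[OF G(1), of k] G(2-4) by auto
    have "r * real n \<le> real m + real t"
      using mt(2) by linarith
    then have "(real k + 1) * (r * real n) \<le> (real k + 1) * (real m + real t)"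
      by (intro mult_left_mono) auto
    \<comment> \<open>The right-hand side (k + 1)(m + t) equals n + k m, which eliminates
      \<open>t\<close>.\<close>
    then have *: "((real k + 1) * r - 1) * real n \<le> real k * real m"
      using mt(1) by (simp add: algebra_simps)
    have "real k * real n \<le> real N * ((real k + 1) * r - 1) * real n"
      using kN by (rule mult_right_mono) simp
    also have "\<dots> \<le> real N * (real k * real m)"
      using * mult_left_mono[of _ _ "real N"] by (simp add: mult.assoc)
    finally have "real k * real n \<le> real k * (real N * real m)"
      by (simp add: mult_ac)
    then have "n \<le> N * m"
      using k1 by (simp flip: of_nat_mult)
    then have "inverse_ramsey n k \<le> N * inverse_ramsey m k"
      by (rule inverse_ramsey_le_mult[OF k1])
    also have "\<dots> \<le> N * Q n ?c"
      using mt(3) by simp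
    finally have "real (inverse_ramsey n k) \<le> real N * real (Q n ?c)"
      by (simp flip: of_nat_mult)
    then show "1 / real N * real (inverse_ramsey n k) \<le> real (Q n ?c)"
      using N1 by (simp add: field_simps)
  qed
  show ?thesis
  proof (intro exI[of _ "1 / real N"] conjI)
    show "\<forall>\<^sub>F n in sequentially.
        1 / real N * real (inverse_ramsey n k) \<le> real (Q n (nat \<lceil>r * real n\<rceil>)) \<and>
        Q n (nat \<lceil>r * real n\<rceil>) \<le> inverse_ramsey n k"
      using eventually_ge_at_top[of 1] by eventually_elim (rule main)
  qed (use N1 in auto)
qed

end
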